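(* Let $r>0$, $p\geq1$ and $m=\frac{p+1}{2}$. Let $x_0(p)$ be the first zero of the solution $u_{p,\mathrm{ex}}$ of the initial value problem $u''=-x^ru^p$, $u(0)=1$, $u'(0)=0$. Then $$\bigl[(r+1)(r+2)\bigr]^{\frac1{r+2}}<x_0(p)<\Bigl[\frac{(r+1)^2(r+2)}{r+m+1}\Bigr]^{\frac1{r+2}}\Bigl(1+\frac{m}{r+1}\Bigr).$$
   Context: The solution $u_{p,\mathrm{ex}}$ is positive and strictly decreasing on $(0,x_0(p))$; $x_0(p)$ is the smallest $x>0$ at which it vanishes. *)

theory Defs
  imports Complex_Main
begin

text \<open>
  A classical solution of \<open>u'' = - x^r u^p\<close>, \<open>u(0) = 1\<close>, \<open>u'(0) = 0\<close> on an interval \<open>I\<close> with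
  left endpoint \<open>0\<close>; derivatives at the endpoints belonging to \<open>I\<close> are one-sided. Both powers
  have real exponents. The term \<open>u^p\<close> is meaningful only where \<open>u \<ge> 0\<close>, so \<open>I\<close> should not
  extend beyond the first zero of \<open>u\<close>.
\<close>

definition ivp_solution_on :: "real \<Rightarrow> real \<Rightarrow> real set \<Rightarrow> (real \<Rightarrow> real) \<Rightarrow> bool" where
  "ivp_solution_on r p I u \<longleftrightarrow>
     u 0 = 1 \<and>
     (\<exists>u'. u' 0 = 0 \<and>
        (\<forall>x\<in>I. (u has_real_derivative u' x) (at x within I)) \<and>
        (\<forall>x\<in>I. (u' has_real_derivative - (x powr r * u x powr p)) (at x within I)))"

definition first_zero :: "(real \<Rightarrow> real) \<Rightarrow> real \<Rightarrow> bool" where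
  "first_zero u x\<^sub>0 \<longleftrightarrow> 0 < x\<^sub>0 \<and> u x\<^sub>0 = 0 \<and> (\<forall>x. 0 < x \<and> x < x\<^sub>0 \<longrightarrow> u x \<noteq> 0)"

end

theory Submission
  imports Defs
begin

text \<open>
  Write \<open>v = -u'\<close> and \<open>c = r + 1\<close>. The lower bound follows by integrating \<open>u'' > - x^r\<close> twice.
  For the upper bound, the Pohozaev-type function \<open>P = x v^2 + x^c u^(p+1) / m - (c/m) u v\<close> has
  derivative \<open>(1 + c/m) v^2\<close>, so it is positive. The function
  \<open>H = x^c u / v - (m-1)/(c+1) x^(c+1)\<close> satisfies \<open>H' = - m x^r P / v^2 < 0\<close> and tends to \<open>c\<close>
  at \<open>0\<close>, whence \<open>H < c\<close>. Evaluated at the point \<open>A\<close> with \<open>A^(c+1) = c^2 (c+1) / (c+m)\<close> this says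
  \<open>u / v < A m / c\<close>. As \<open>u\<close> is concave, \<open>x\<^sub>0\<close> lies to the left of the zero \<open>A + u(A) / v(A)\<close> of
  the tangent at \<open>A\<close>.
\<close>

locale emden_fowler =
  fixes r p z :: real and u v :: "real \<Rightarrow> real"
  assumes r_pos: "r > 0" and p_ge_1: "p \<ge> 1" and zero_pos: "z > 0"
    and u_0: "u 0 = 1" and v_0: "v 0 = 0" and u_z: "u z = 0"
    and u_nonzero: "\<And>x. 0 < x \<Longrightarrow> x < z \<Longrightarrow> u x \<noteq> 0"
    and u_deriv_within: "\<And>x. x \<in> {0..z} \<Longrightarrow> (u has_real_derivative - v x) (at x within {0..z})"
    and v_deriv_within:
      "\<And>x. x \<in> {0..z} \<Longrightarrow> (v has_real_derivative x powr r * u x powr p) (at x within {0..z})"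
begin

section \<open>Regularity, signs and monotonicity of \<open>u\<close> and \<open>v\<close>\<close>

lemma u_deriv: "0 < x \<Longrightarrow> x < z \<Longrightarrow> (u has_real_derivative - v x) (at x)"
  using u_deriv_within[of x] by (simp add: at_within_Icc_at)

lemma v_deriv: "0 < x \<Longrightarrow> x < z \<Longrightarrow> (v has_real_derivative x powr r * u x powr p) (at x)"
  using v_deriv_within[of x] by (simp add: at_within_Icc_at)

lemma continuous_on_u: "A \<subseteq> {0..z} \<Longrightarrow> continuous_on A u"
  using DERIV_continuous_on[OF u_deriv_within] continuous_on_subset by blast

lemma continuous_on_v: "A \<subseteq> {0..z} \<Longrightarrow> continuous_on A v"
  using DERIV_continuous_on[OF v_deriv_within] continuous_on_subset by blast

lemma powr_deriv: "0 < x \<Longrightarrow> ((\<lambda>x. x powr (r + 1)) has_real_derivative (r + 1) * x powr r) (at x)"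
  using has_real_derivative_powr[of x "r + 1"] by simp

lemma continuous_on_powr_div:
  "a > 0 \<Longrightarrow> b \<noteq> 0 \<Longrightarrow> continuous_on {0..x} (\<lambda>x. x powr a / b)" for a b x :: real
  by (intro continuous_on_divide continuous_on_powr' continuous_on_id continuous_on_const) auto

lemma u_pos:
  assumes "0 \<le> x" "x < z"
  shows "u x > 0"
proof (rule ccontr)
  assume "\<not> u x > 0"
  then obtain y where "0 \<le> y" "y \<le> x" "u y = 0"
    using IVT2'[of u x 0 0] assms u_0 continuous_on_u[of "{0..x}"] by auto
  moreover from this have "y \<noteq> 0"
    using u_0 by auto
  ultimately show False
    using u_nonzero[of y] assms by simp
qed

lemma v_less:
  assumes "0 \<le> x" "x < y" "y \<le> z"
  shows "v x < v y"
proof (rule DERIV_pos_imp_increasing_open[OF assms(2)])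
  fix s assume "x < s" "s < y"
  then show "\<exists>d. (v has_real_derivative d) (at s) \<and> 0 < d"
    using assms v_deriv[of s] u_pos[of s] by (intro exI[of _ "s powr r * u s powr p"]) auto
qed (use assms in \<open>auto intro!: continuous_on_v\<close>)

lemma v_pos: "0 < x \<Longrightarrow> x \<le> z \<Longrightarrow> v x > 0"
  using v_less[of 0 x] v_0 by simp

lemma u_less:
  assumes "0 \<le> x" "x < y" "y \<le> z"
  shows "u y < u x"
proof (rule DERIV_neg_imp_decreasing_open[OF assms(2)])
  fix s assume "x < s" "s < y"
  then show "\<exists>d. (u has_real_derivative d) (at s) \<and> d < 0"
    using assms u_deriv[of s] v_pos[of s] by (intro exI[of _ "- v s"]) auto
qed (use assms in \<open>auto intro!: continuous_on_u\<close>)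

section \<open>Comparison bounds for \<open>v\<close> and the lower bound for the zero\<close>

lemma v_upper:
  assumes "0 < x" "x \<le> z"
  shows "v x < x powr (r + 1) / (r + 1)"
proof -
  define g where "g s = s powr (r + 1) / (r + 1) - v s" for s
  have "g 0 < g x"
  proof (rule DERIV_pos_imp_increasing_open[OF assms(1)])
    fix s assume s: "0 < s" "s < x"
    have "u s powr p < 1"
      using s assms u_less[of 0 s] u_0 u_pos[of s] p_ge_1 powr_less_mono2[of p "u s" 1] by simp
    then have "s powr r - s powr r * u s powr p > 0"
      using s by (simp add: mult_less_cancel_left1)
    moreover have "(g has_real_derivative
        (r + 1) * s powr r / (r + 1) - s powr r * u s powr p) (at s)"
      unfolding g_def using s assms by (intro DERIV_diff DERIV_cdivide powr_deriv v_deriv) auto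
    then have "(g has_real_derivative s powr r - s powr r * u s powr p) (at s)"
      using r_pos by simp
    ultimately show "\<exists>d. (g has_real_derivative d) (at s) \<and> 0 < d"
      by blast
  next
    show "continuous_on {0..x} g"
      unfolding g_def using assms r_pos
      by (intro continuous_on_diff continuous_on_powr_div continuous_on_mult continuous_on_const
            continuous_on_v) auto
  qed
  then show ?thesis
    using r_pos by (simp add: g_def v_0)
qed

text \<open>As \<open>u\<close> decreases, \<open>u s powr p\<close> is at least its value at the
  right end \<open>x\<close>, and \<open>v'\<close> is compared with that constant times
  \<open>s powr r\<close>. This later controls the quotient in \<open>H\<close> near 0, where
  \<open>v\<close> vanishes.\<close>

lemma v_lower:
  assumes "0 < x" "x < z"
  shows "u x powr p * x powr (r + 1) / (r + 1) \<le> v x"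
proof -
  define g where "g s = v s - u x powr p * (s powr (r + 1) / (r + 1))" for s
  have "g 0 \<le> g x"
  proof (rule DERIV_nonneg_imp_increasing_open[where f = g])
    fix s assume s: "0 < s" "s < x"
    have "u x powr p \<le> u s powr p"
      using s assms u_less[of s x] u_pos[of x] p_ge_1 by (intro powr_mono2) auto
    then have "s powr r * u s powr p - u x powr p * s powr r \<ge> 0"
      using mult_left_mono[of "u x powr p" "u s powr p" "s powr r"] by (simp add: mult.commute)
    moreover have "(g has_real_derivative
        s powr r * u s powr p - u x powr p * ((r + 1) * s powr r / (r + 1))) (at s)"
      unfolding g_def using s assms
      by (intro DERIV_diff DERIV_cdivide DERIV_cmult powr_deriv v_deriv) auto
    then have "(g has_real_derivative s powr r * u s powr p - u x powr p * s powr r) (at s)"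
      using r_pos by simp
    ultimately show "\<exists>d. (g has_real_derivative d) (at s) \<and> 0 \<le> d"
      by blast
  next
    show "continuous_on {0..x} g"
      unfolding g_def using assms r_pos
      by (intro continuous_on_diff continuous_on_powr_div continuous_on_mult continuous_on_const
            continuous_on_v) auto
  qed (use assms in auto)
  then show ?thesis
    using r_pos by (simp add: g_def v_0)
qed

text \<open>By \<open>v_upper\<close> the auxiliary function \<open>g\<close> increases strictly;
  \<open>g 0\<close> is 1, and at \<open>z\<close> only its power term survives.\<close>

lemma zero_lower: "(r + 1) * (r + 2) < z powr (r + 2)"
proof -
  define g where "g s = s powr (r + 2) / ((r + 1) * (r + 2)) + u s" for s
  have "g 0 < g z"
  proof (rule DERIV_pos_imp_increasing_open[OF zero_pos])
    fix s assume s: "0 < s" "s < z"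
    have "((\<lambda>s. s powr (r + 2)) has_real_derivative (r + 2) * s powr (r + 2 - 1)) (at s)"
      using s by (intro has_real_derivative_powr) auto
    then have "(g has_real_derivative (r + 2) * s powr (r + 2 - 1) / ((r + 1) * (r + 2)) + - v s) (at s)"
      unfolding g_def using s by (intro DERIV_add DERIV_cdivide u_deriv) auto
    moreover have "(r + 2) * s powr (r + 2 - 1) / ((r + 1) * (r + 2)) = s powr (r + 1) / (r + 1)"
      using r_pos by (simp add: add.commute)
    ultimately show "\<exists>d. (g has_real_derivative d) (at s) \<and> 0 < d"
      using v_upper[of s] s by (intro exI[of _ "s powr (r + 1) / (r + 1) + - v s"]) auto
  next
    show "continuous_on {0..z} g"
      unfolding g_def using r_pos
      by (intro continuous_on_add continuous_on_powr_div continuous_on_u) auto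
  qed
  then show ?thesis
    using r_pos by (simp add: g_def u_0 u_z less_divide_eq)
qed

section \<open>The Pohozaev-type function\<close>

definition pohozaev :: "real \<Rightarrow> real" where
  "pohozaev x = x * (v x)\<^sup>2 + x powr (r + 1) * u x powr (p + 1) / ((p + 1) / 2)
     - (r + 1) / ((p + 1) / 2) * (u x * v x)"

text \<open>The coefficients are chosen so that on differentiation the terms in
  \<open>u powr p * v\<close> cancel, and so do those in \<open>u powr (p + 1)\<close>. Only a
  positive multiple of the square of \<open>v\<close> remains, and the function vanishes at
  0.\<close>

lemma pohozaev_pos:
  assumes "0 < x" "x < z"
  shows "pohozaev x > 0"
proof -
  have "pohozaev 0 < pohozaev x"
  proof (rule DERIV_pos_imp_increasing_open[OF assms(1)])
    fix s assume s: "0 < s" "s < x"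
    have us: "u s > 0" and vs: "v s > 0"
      using s assms u_pos v_pos by auto
    have up: "((\<lambda>s. u s powr (p + 1)) has_real_derivative (p + 1) * u s powr p * (- v s)) (at s)"
      using DERIV_chain2[OF has_real_derivative_powr[OF us] u_deriv[of s], of "p + 1"] s assms
      by simp
    have eq: "u s powr (p + 1) = u s * u s powr p" "s powr (r + 1) = s * s powr r"
      using us s by (simp_all add: powr_add)
    have "(pohozaev has_real_derivative
        1 * (v s * v s) + (s powr r * u s powr p * v s + s powr r * u s powr p * v s) * s
        + ((r + 1) * s powr r * u s powr (p + 1)
            + (p + 1) * u s powr p * (- v s) * s powr (r + 1)) / ((p + 1) / 2)
        - (r + 1) / ((p + 1) / 2) * (- v s * v s + s powr r * u s powr p * u s)) (at s)"
      unfolding pohozaev_def power2_eq_square using s assms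
      by (intro DERIV_diff DERIV_add DERIV_mult DERIV_cdivide DERIV_cmult DERIV_ident
            up powr_deriv u_deriv v_deriv) auto
    also have "1 * (v s * v s) + (s powr r * u s powr p * v s + s powr r * u s powr p * v s) * s
        + ((r + 1) * s powr r * u s powr (p + 1)
            + (p + 1) * u s powr p * (- v s) * s powr (r + 1)) / ((p + 1) / 2)
        - (r + 1) / ((p + 1) / 2) * (- v s * v s + s powr r * u s powr p * u s)
      = (1 + (r + 1) / ((p + 1) / 2)) * (v s)\<^sup>2"
      unfolding eq using p_ge_1
      by (simp add: divide_simps power2_eq_square) (simp add: algebra_simps)
    finally have "(pohozaev has_real_derivative (1 + (r + 1) / ((p + 1) / 2)) * (v s)\<^sup>2) (at s)" .
    moreover have "(1 + (r + 1) / ((p + 1) / 2)) * (v s)\<^sup>2 > 0"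
      using vs r_pos p_ge_1 by (intro mult_pos_pos add_pos_pos) auto
    ultimately show "\<exists>d. (pohozaev has_real_derivative d) (at s) \<and> 0 < d"
      by blast
  next
    \<comment> \<open>\<open>continuous_on_powr'\<close> asks for nonnegative bases, here
      \<open>u\<close>.\<close>
    have "\<forall>y\<in>{0..x}. u y \<ge> 0"
      using u_pos assms by (auto intro!: less_imp_le)
    then show "continuous_on {0..x} pohozaev"
      unfolding pohozaev_def using assms r_pos p_ge_1
      by (intro continuous_on_add continuous_on_diff continuous_on_mult continuous_on_divide
            continuous_on_power continuous_on_const continuous_on_id continuous_on_powr'
            continuous_on_u continuous_on_v) auto
  qed
  then show ?thesis
    using r_pos by (simp add: pohozaev_def v_0)
qed

section \<open>The decreasing function \<open>H\<close> and its bound near 0\<close>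

definition H :: "real \<Rightarrow> real" where
  "H x = x powr (r + 1) * u x / v x - ((p + 1) / 2 - 1) / (r + 2) * x powr (r + 2)"

text \<open>Differentiating the quotient yields a term \<open>- x powr (r + 1)\<close>. The
  subtracted power in \<open>H\<close> raises its coefficient to \<open>(p + 1) / 2\<close>, which
  is what makes the derivative a negative multiple of \<open>pohozaev\<close>.\<close>

lemma H_less:
  assumes "0 < x" "x < y" "y < z"
  shows "H y < H x"
proof (rule DERIV_neg_imp_decreasing[OF assms(2)])
  fix s assume s: "x \<le> s" "s \<le> y"
  then have s': "0 < s" "s < z"
    using assms by auto
  have us: "u s > 0" and vs: "v s > 0"
    using s' u_pos v_pos by auto
  have xp2: "((\<lambda>s. s powr (r + 2)) has_real_derivative (r + 2) * s powr (r + 1)) (at s)"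
    using has_real_derivative_powr[of s "r + 2"] s' by (simp add: add.commute)
  have eq: "u s powr (p + 1) = u s * u s powr p" "s powr (r + 1) = s * s powr r"
    using us s' by (simp_all add: powr_add)
  have "(H has_real_derivative
      (((r + 1) * s powr r * u s + - v s * s powr (r + 1)) * v s
        - s powr (r + 1) * u s * (s powr r * u s powr p)) / (v s * v s)
      - ((p + 1) / 2 - 1) / (r + 2) * ((r + 2) * s powr (r + 1))) (at s)"
    unfolding H_def using vs s'
    by (intro DERIV_diff DERIV_divide DERIV_mult DERIV_cmult powr_deriv xp2 u_deriv v_deriv) auto
  also have "(((r + 1) * s powr r * u s + - v s * s powr (r + 1)) * v s
        - s powr (r + 1) * u s * (s powr r * u s powr p)) / (v s * v s)
      - ((p + 1) / 2 - 1) / (r + 2) * ((r + 2) * s powr (r + 1))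
    = - ((p + 1) / 2 * s powr r * pohozaev s / (v s)\<^sup>2)"
    using vs r_pos p_ge_1 unfolding pohozaev_def eq
    by (simp add: divide_simps power2_eq_square) (simp add: algebra_simps)
  finally show "\<exists>d. (H has_real_derivative d) (at s) \<and> d < 0"
    using vs s' p_ge_1 pohozaev_pos[OF s']
    by (intro exI[of _ "- ((p + 1) / 2 * s powr r * pohozaev s / (v s)\<^sup>2)"]) auto
qed

text \<open>Multiplying \<open>v_lower\<close> by \<open>u x powr (1 - p)\<close> turns
  \<open>u powr p\<close> into \<open>u\<close>. The resulting bound tends to \<open>r + 1\<close>
  at 0, so the exact limit of \<open>H\<close> need not be computed.\<close>

lemma H_le:
  assumes "0 < x" "x < z"
  shows "H x \<le> (r + 1) * u x powr (1 - p)"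
proof -
  have us: "u x > 0" and vs: "v x > 0"
    using assms u_pos v_pos by auto
  have "x powr (r + 1) * u x powr p \<le> (r + 1) * v x"
    using v_lower[OF assms] r_pos by (simp add: field_simps)
  then have "x powr (r + 1) * u x powr p * u x powr (1 - p) \<le> (r + 1) * v x * u x powr (1 - p)"
    by (rule mult_right_mono) simp
  then have "x powr (r + 1) * u x / v x \<le> (r + 1) * u x powr (1 - p)"
    using us vs by (simp add: mult.assoc powr_add[symmetric]) (simp add: field_simps)
  moreover have "((p + 1) / 2 - 1) / (r + 2) * x powr (r + 2) \<ge> 0"
    using p_ge_1 r_pos by simp
  ultimately show ?thesis
    unfolding H_def by linarith
qed

lemma H_less_limit:
  assumes "0 < x" "x < z"
  shows "H x < r + 1"
proof -
  have "continuous (at 0 within {0..z}) u"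
    using continuous_on_u[of "{0..z}"] zero_pos by (simp add: continuous_on_eq_continuous_within)
  then have "(u \<longlongrightarrow> 1) (at_right 0)"
    using zero_pos u_0 by (simp add: continuous_within at_within_Icc_at_right)
  then have "((\<lambda>s. (r + 1) * u s powr (1 - p)) \<longlongrightarrow> (r + 1) * 1 powr (1 - p)) (at_right 0)"
    by (intro tendsto_intros) auto
  \<comment> \<open>\<open>H 0\<close> is 0 by the convention for division by zero, so the
    comparison uses \<open>s\<close> tending to 0 from the right. The limit gives only a weak
    inequality at \<open>x / 2\<close>; the decrease from \<open>x / 2\<close> to \<open>x\<close>
    makes it strict.\<close>
  moreover have "eventually (\<lambda>s. H (x / 2) \<le> (r + 1) * u s powr (1 - p)) (at_right 0)"
    using eventually_at_right_real[of 0 "x / 2"] assms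
    by (auto elim!: eventually_mono intro!: order.trans[OF less_imp_le[OF H_less] H_le])
  ultimately have "H (x / 2) \<le> (r + 1) * 1 powr (1 - p)"
    by (intro tendsto_lowerbound) auto
  then show ?thesis
    using H_less[of "x / 2" x] assms by simp
qed

section \<open>The tangent argument and the upper bound\<close>

lemma zero_le_tangent_zero:
  assumes "0 < x" "x < z"
  shows "z \<le> x + u x / v x"
proof -
  \<comment> \<open>\<open>t\<close> differs by a constant from \<open>u\<close> minus its tangent
    at \<open>x\<close>. It is nonincreasing to the right of \<open>x\<close> because
    \<open>v\<close> increases.\<close>
  define t where "t s = u s + v x * (s - x)" for s
  have "t z \<le> t x"
  proof (rule DERIV_nonpos_imp_decreasing_open[where f = t])
    fix s assume s: "x < s" "s < z"
    then have "(t has_real_derivative - v s + v x) (at s)"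
      unfolding t_def using assms by (auto intro!: derivative_eq_intros u_deriv)
    then show "\<exists>d. (t has_real_derivative d) (at s) \<and> d \<le> 0"
      using v_less[of x s] s assms by (intro exI[of _ "- v s + v x"]) auto
  qed (use assms in \<open>auto simp: t_def intro!: continuous_intros continuous_on_u\<close>)
  then have "v x * (z - x) \<le> u x"
    by (simp add: t_def u_z)
  then have "z - x \<le> u x / v x"
    using v_pos[of x] assms by (simp add: field_simps)
  then show ?thesis
    by simp
qed

text \<open>With \<open>c = r + 1\<close>, the bound \<open>H x < c\<close> makes the tangent zero
  at \<open>x\<close> smaller than \<open>x * (m + c) / (c + 1) + c / x powr c\<close>. The point
  \<open>A\<close> minimises this expression, and the claimed bound is its minimum.\<close>

lemma zero_upper:
  fixes m A :: real
  assumes "m = (p + 1) / 2"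
    and A: "A = ((r + 1)\<^sup>2 * (r + 2) / (r + m + 1)) powr (1 / (r + 2))"
  shows "z < A * (1 + m / (r + 1))"
proof (cases "A < z")
  case True
  have m: "m \<ge> 1"
    using assms p_ge_1 by simp
  then have A_pos: "A > 0"
    using r_pos by (simp add: A)
  have A_powr: "A powr (r + 2) = (r + 1)\<^sup>2 * (r + 2) / (r + m + 1)"
    using r_pos m by (simp add: A powr_powr)
  define y where "y = u A / v A"
  \<comment> \<open>The factor \<open>A / A\<close> is inserted to isolate the ratio
    \<open>y / A\<close>.\<close>
  have "H A = A powr (r + 1) * A * y / A - (m - 1) / (r + 2) * A powr (r + 2)"
    using A_pos unfolding H_def y_def assms(1) by simp
  also have "A powr (r + 1) * A = A powr (r + 2)"
    using A_pos powr_add[of A "r + 1" 1] by (simp add: add.commute)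
  finally have "A powr (r + 2) * (y / A) < (r + 1) + (m - 1) / (r + 2) * A powr (r + 2)"
    using H_less_limit[OF A_pos True] by simp
  \<comment> \<open>By the choice of \<open>A\<close>, multiplying \<open>A powr (r + 2)\<close> by
    \<open>m / (r + 1) - (m - 1) / (r + 2)\<close> gives exactly \<open>r + 1\<close>.\<close>
  also have "\<dots> = A powr (r + 2) * (m / (r + 1))"
    unfolding A_powr using r_pos m by (simp add: divide_simps power2_eq_square) (simp add: algebra_simps)
  finally have "y / A < m / (r + 1)"
    using A_pos by (subst (asm) mult_less_cancel_left_pos) auto
  then have "A + y < A * (1 + m / (r + 1))"
    using A_pos by (simp add: pos_divide_less_eq algebra_simps)
  then show ?thesis
    using zero_le_tangent_zero[OF A_pos True] by (simp add: y_def)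
next
  case False
  then have "z \<le> A"
    by simp
  also have "A < A * (1 + m / (r + 1))"
    using False zero_pos r_pos assms(1) p_ge_1 by (simp add: distrib_left)
  finally show ?thesis .
qed

end

theorem lemma2p5:
  fixes r p m x\<^sub>0 :: real and u :: "real \<Rightarrow> real"
  assumes "r > 0" and "p \<ge> 1" and "m = (p + 1) / 2"
    and "ivp_solution_on r p {0..x\<^sub>0} u"
    and "first_zero u x\<^sub>0"
  shows "((r + 1) * (r + 2)) powr (1 / (r + 2)) < x\<^sub>0 \<and>
         x\<^sub>0 < ((r + 1)^2 * (r + 2) / (r + m + 1)) powr (1 / (r + 2)) * (1 + m / (r + 1))"
proof -
  obtain u' where u': "u 0 = 1" "u' 0 = 0"
      "\<And>x. x \<in> {0..x\<^sub>0} \<Longrightarrow> (u has_real_derivative u' x) (at x within {0..x\<^sub>0})"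
      "\<And>x. x \<in> {0..x\<^sub>0} \<Longrightarrow>
        (u' has_real_derivative - (x powr r * u x powr p)) (at x within {0..x\<^sub>0})"
    using assms(4) unfolding ivp_solution_on_def by blast
  have "((\<lambda>x. - u' x) has_real_derivative x powr r * u x powr p) (at x within {0..x\<^sub>0})"
    if "x \<in> {0..x\<^sub>0}" for x
    using DERIV_minus[OF u'(4)[OF that]] by simp
  then interpret emden_fowler r p x\<^sub>0 u "\<lambda>x. - u' x"
    using assms u' by unfold_locales (auto simp: first_zero_def)
  have "((r + 1) * (r + 2)) powr (1 / (r + 2)) < (x\<^sub>0 powr (r + 2)) powr (1 / (r + 2))"
    using zero_lower assms(1) by (intro powr_less_mono2) auto
  also have "\<dots> = x\<^sub>0"
    using zero_pos assms(1) by (simp add: powr_powr)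
  finally show ?thesis
    using zero_upper[OF assms(3) refl] by simp
qed

end
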